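(* Let $b_2>0$ be a constant with property (P) (defined in the context), and let $b_3$ be a positive constant such that $\frac{b_3 \log 2}{8} > b_2 + 4$ (where here $\log 2$ is the ordinary natural logarithm of $2$). There exist constants $b_5>0$ and $b_6>5$ such that the following holds. Let $\psi:\mathbb{N}\to[0,\infty)$ be a function such that for every $n$ either $\psi(n)=0$ or $1/n \le \psi(n)\le 1/2$, and such that for all positive integers $k$ and $r$ the set $S_k^r$ is either empty or satisfies $r \le k$ and $$\frac{2^r}{k^2} \le \# S_k^r \le k 2^r .$$ Let $S_{k_1}^{r_1}$ and $S_{k_2}^{r_2}$ be two such sets with $k_1 \geq k_2$. Assume that $$ |k_1 - k_2| \leq b_3 \log k_1 \qquad \text{as well as} \qquad |r_1 - r_2| \leq b_3 \log k_1. $$ Then the number of pairs of integers $m \in S_{k_1}^{r_1}$ and $n \in S_{k_2}^{r_2}$ for which both inequalities $$ (m,n) \geq \frac{2^{k_1+1} 2^{-r_2}}{k_1^{b_3 + 1}} \qquad\text{and}\qquad \omega\left(\frac{mn}{(m,n)^2} \right) \geq b_5 \log k_1 $$ hold is at most $$ 2^{r_1} 2^{r_2} k_1^{-b_6}, $$ provided that $k_1$ and $k_2$ are sufficiently large.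
   Context: $\mathbb{N}$ is the set of positive integers, $(m,n)$ is the greatest common divisor, and $\omega(\cdot)$ denotes the number of distinct prime factors of an integer. Convention: $\log x$ is understood as $\max(1,\log x)$ for variable arguments. For positive integers $k$ and $r$, $$S_k^r := \{2^k < n \leq 2^{k+1}:~ \psi(n) \in [2^{-r-1},2^{-r}] \}.$$ Property (P) of a constant $b_2>0$: for all finite sets $\mathcal{M}_1 \subset [2^{k_1},2^{k_1+1}]$, $\mathcal{M}_2\subset [2^{k_2},2^{k_2+1}]$ of positive integers (with $k_1,k_2$ any positive integers), of cardinalities $N_1\le N_2$ which are sufficiently large (larger than some absolute constant), and every real $R>1$, one has $$\sum_{\substack{m \in \mathcal{M}_1,\ n \in \mathcal{M}_2,\\ R \leq (m,n) \leq R \log N_2}} \frac{(m,n)^{1/2}}{(mn)^{1/4}} \leq (N_1 N_2)^{3/4} (\log N_2)^{b_2}.$$ (Such a constant exists.) "Sufficiently large" for $k_1,k_2$ means larger than a constant independent of $\psi$, $r_1$, $r_2$. *)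

theory Defs
  imports Complex_Main "HOL-Computational_Algebra.Primes"
begin

text \<open>The natural logarithm, truncated below at 1; used for all logarithms of variable arguments.\<close>

definition tlog :: "real \<Rightarrow> real" where
  "tlog x = max 1 (ln x)"

definition omega :: "nat \<Rightarrow> nat" where
  "omega n = card (prime_factors n)"

definition S :: "(nat \<Rightarrow> real) \<Rightarrow> nat \<Rightarrow> nat \<Rightarrow> nat set" where
  "S \<psi> k r = {n. 2 ^ k < n \<and> n \<le> 2 ^ (k + 1) \<and> \<psi> n \<in> {1 / 2 ^ (r + 1) .. 1 / 2 ^ r}}"

text \<open>The threshold \<open>N\<^sub>0\<close> may depend on \<open>b\<close>, but on nothing else.\<close>

definition property_P :: "real \<Rightarrow> bool" where
  "property_P b \<longleftrightarrow>
    (\<exists>N\<^sub>0 :: nat. \<forall>k\<^sub>1\<ge>1. \<forall>k\<^sub>2\<ge>1. \<forall>M\<^sub>1 M\<^sub>2 :: nat set. \<forall>R :: real.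
      finite M\<^sub>1 \<longrightarrow> finite M\<^sub>2 \<longrightarrow>
      M\<^sub>1 \<subseteq> {2 ^ k\<^sub>1 .. 2 ^ (k\<^sub>1 + 1)} \<longrightarrow> M\<^sub>2 \<subseteq> {2 ^ k\<^sub>2 .. 2 ^ (k\<^sub>2 + 1)} \<longrightarrow>
      N\<^sub>0 < card M\<^sub>1 \<longrightarrow> card M\<^sub>1 \<le> card M\<^sub>2 \<longrightarrow> R > 1 \<longrightarrow>
      (\<Sum>(m, n) \<in> {(m, n). m \<in> M\<^sub>1 \<and> n \<in> M\<^sub>2 \<and>
                      R \<le> real (gcd m n) \<and> real (gcd m n) \<le> R * tlog (real (card M\<^sub>2))}.
          real (gcd m n) powr (1/2) / real (m * n) powr (1/4))
        \<le> (real (card M\<^sub>1) * real (card M\<^sub>2)) powr (3/4) * tlog (real (card M\<^sub>2)) powr b)"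

text \<open>Functions on the positive integers are modelled on \<^typ>\<open>nat\<close>, the value at 0 being
  irrelevant.\<close>

definition admissible :: "(nat \<Rightarrow> real) \<Rightarrow> bool" where
  "admissible \<psi> \<longleftrightarrow>
    (\<forall>n\<ge>1. \<psi> n \<ge> 0 \<and> (\<psi> n = 0 \<or> (1 / real n \<le> \<psi> n \<and> \<psi> n \<le> 1/2))) \<and>
    (\<forall>k\<ge>1. \<forall>r\<ge>1. S \<psi> k r = {} \<or>
      (r \<le> k \<and> 2 ^ r / real k ^ 2 \<le> real (card (S \<psi> k r)) \<and>
       real (card (S \<psi> k r)) \<le> real k * 2 ^ r))"

end

theory Submission
  imports Defs
begin

text \<open>
  Put \<open>k = k\<^sub>1\<close> and \<open>q = mn/(m,n)\<^sup>2\<close>. The pairs are counted by Rankin's trick: instead of pairs with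
  \<open>\<omega>(q) \<ge> b\<^sub>5 log k\<close> one sums the weight \<open>2\<^bsup>\<omega>(q)\<^esup> q\<^bsup>-1/4\<^esup>\<close> over all pairs with a large gcd.

  Since \<open>q\<close> is the product of the powers \<open>p\<^bsup>\<bar>v\<^sub>p(m) - v\<^sub>p(n)\<bar>\<^esup>\<close>, the weight is a product over the primes of
  kernels in the exponents of \<open>m\<close> and \<open>n\<close>. The kernel at \<open>p\<close> is 1 on the diagonal and
  \<open>2 p\<^bsup>-\<bar>i-j\<bar>/4\<^esup>\<close> off it. The decisive fact is that, as a bilinear form on \<open>\<ell>\<^bsup>4/3\<^esup> \<times> \<ell>\<^bsup>4/3\<^esup>\<close>, this
  kernel has norm \<open>1 + O(1/p)\<close> (lemma \<open>exponent_kernel_bound\<close>). The reason is visible for sequences of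
  the form \<open>(1, \<epsilon>)\<close> with small \<open>\<epsilon>\<close>: the off-diagonal gain is a constant times \<open>p\<^bsup>-1/4\<^esup> \<epsilon>\<close>, the product of the norms
  exceeds the diagonal part by about \<open>(3/2) \<epsilon>\<^bsup>4/3\<^esup>\<close>, and by Young's inequality the former is at most the
  latter plus \<open>O(1/p)\<close>. An exponent 2 in place of \<open>4/3\<close> would only give \<open>1 + O(p\<^bsup>-1/4\<^esup>)\<close>.

  Norms multiply under tensor products (lemma \<open>tensorised_kernel_bound\<close>). Hence the weighted sum
  over pairs in \<open>A \<times> B\<close> for which all primes of \<open>q\<close> are at most \<open>z\<close> is bounded by \<open>(#A #B)\<^bsup>3/4\<^esup>\<close> times
  the product of \<open>1 + O(1/p)\<close> over \<open>p \<le> z\<close> (lemma \<open>weighted_gcd_sum_bound\<close>), and by a Chebyshev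
  type estimate this product is at most a fixed power of \<open>log z\<close>.

  In the situation of the theorem the lower bound for \<open>(m,n)\<close> makes both cofactors of the gcd at most
  \<open>X = 2\<^bsup>r\<^sub>2\<^esup> k\<^bsup>b\<^sub>3 + 1\<^esup>\<close>. Hence \<open>q \<le> X\<^sup>2\<close>, its primes are at most \<open>X \<le> 4\<^sup>k\<close>, and the product over primes
  is a power of \<open>k\<close>. The set sizes are at most \<open>k 2\<^bsup>r\<^sub>1\<^esup>\<close> and \<open>k 2\<^bsup>r\<^sub>2\<^esup>\<close>, so the number of pairs is at most
  \<open>2\<^bsup>3(r\<^sub>1+r\<^sub>2)/4 + r\<^sub>2/2\<^esup> = 2\<^bsup>r\<^sub>1 + r\<^sub>2 + (r\<^sub>2-r\<^sub>1)/4\<^esup>\<close> times \<open>k\<^bsup>O(1) - b\<^sub>5 log 2\<^esup>\<close>. Because \<open>r\<^sub>2 - r\<^sub>1\<close> is at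
  most \<open>b\<^sub>3 log k\<close>, the factor \<open>2\<^bsup>(r\<^sub>2-r\<^sub>1)/4\<^esup>\<close> is a power of \<open>k\<close> as well, and a large \<open>b\<^sub>5\<close> makes up for all
  these powers.
\<close>

section \<open>A bilinear inequality for the exponents of one prime\<close>

lemma sum_power_le_geometric:
  fixes l :: real
  assumes l: "0 \<le> l" "l < 1" and D: "finite D" "0 \<notin> D"
  shows "(\<Sum>d\<in>D. l ^ d) \<le> l / (1 - l)"
proof -
  have "(\<Sum>d\<in>D. l ^ d) = (\<Sum>d\<in>(\<lambda>d. d - 1) ` D. l * l ^ d)"
  proof (rule sum.reindex_cong[of Suc])
    show "D = Suc ` (\<lambda>d. d - 1) ` D"
    proof (intro equalityI subsetI)
      fix d assume "d \<in> D"
      with D(2) have "d = Suc (d - 1)" by (cases d) auto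
      with \<open>d \<in> D\<close> show "d \<in> Suc ` (\<lambda>d. d - 1) ` D" by blast
    next
      fix d assume "d \<in> Suc ` (\<lambda>d. d - 1) ` D"
      then obtain e where "e \<in> D" "d = Suc (e - 1)" by blast
      with D(2) show "d \<in> D" by (cases e) auto
    qed
  qed auto
  also have "\<dots> = l * (\<Sum>d\<in>(\<lambda>d. d - 1) ` D. l ^ d)"
    by (simp add: sum_distrib_left)
  also have "\<dots> \<le> l * (1 / (1 - l))"
  proof (rule mult_left_mono[OF _ l(1)])
    have "(\<Sum>d\<in>(\<lambda>d. d - 1) ` D. l ^ d) \<le> (\<Sum>d. l ^ d)"
      using l D(1) by (intro sum_le_suminf) (auto intro: summable_geometric)
    also have "\<dots> = 1 / (1 - l)"
      using l by (simp add: suminf_geometric)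
    finally show "(\<Sum>d\<in>(\<lambda>d. d - 1) ` D. l ^ d) \<le> 1 / (1 - l)" .
  qed
  finally show ?thesis by simp
qed

lemma sum_power_distance_le:
  fixes l :: real
  assumes l: "0 \<le> l" "l < 1" and I: "finite I"
  shows "(\<Sum>j\<in>I - {i}. l ^ ((i - j) + (j - i))) \<le> 2 * l / (1 - l)"
proof -
  have "(\<Sum>j\<in>I - {i}. l ^ ((i - j) + (j - i)))
      = (\<Sum>j\<in>{j\<in>I. j < i}. l ^ (i - j)) + (\<Sum>j\<in>{j\<in>I. i < j}. l ^ (j - i))"
  proof -
    have split: "I - {i} = {j\<in>I. j < i} \<union> {j\<in>I. i < j}" by auto
    have "(\<Sum>j\<in>I - {i}. l ^ ((i - j) + (j - i)))
        = (\<Sum>j\<in>{j\<in>I. j < i}. l ^ ((i - j) + (j - i))) + (\<Sum>j\<in>{j\<in>I. i < j}. l ^ ((i - j) + (j - i)))"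
      unfolding split using I by (subst sum.union_disjoint) auto
    then show ?thesis by simp
  qed
  also have "(\<Sum>j\<in>{j\<in>I. j < i}. l ^ (i - j)) = (\<Sum>d\<in>(\<lambda>j. i - j) ` {j\<in>I. j < i}. l ^ d)"
    by (subst sum.reindex) (auto simp: inj_on_def)
  also have "(\<Sum>j\<in>{j\<in>I. i < j}. l ^ (j - i)) = (\<Sum>d\<in>(\<lambda>j. j - i) ` {j\<in>I. i < j}. l ^ d)"
    by (subst sum.reindex) (auto simp: inj_on_def)
  also have "(\<Sum>d\<in>(\<lambda>j. i - j) ` {j\<in>I. j < i}. l ^ d)
      + (\<Sum>d\<in>(\<lambda>j. j - i) ` {j\<in>I. i < j}. l ^ d) \<le> l / (1 - l) + l / (1 - l)"
    using I by (intro add_mono sum_power_le_geometric l) auto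
  finally show ?thesis by simp
qed

text \<open>
  The local factor, at one prime, of the weight \<open>2\<^bsup>\<omega>(q)\<^esup> q\<^bsup>-1/4\<^esup>\<close> with \<open>q = mn/(m,n)\<^sup>2\<close>: the numbers
  \<open>i\<close> and \<open>j\<close> stand for the exponents of the prime \<open>p\<close> in \<open>m\<close> and \<open>n\<close>, so that \<open>p\<close> has exponent
  \<open>\<bar>i - j\<bar>\<close> in \<open>q\<close>; the intended values are \<open>c = 2\<close> and \<open>l = p\<^bsup>-1/4\<^esup>\<close>. The absolute difference
  is the sum of the two truncated ones.
\<close>

definition exponent_kernel :: "real \<Rightarrow> real \<Rightarrow> nat \<Rightarrow> nat \<Rightarrow> real" where
  "exponent_kernel c l i j = (if i = j then 1 else c * l ^ ((i - j) + (j - i)))"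

text \<open>
  A bound for the norm of the kernel as a bilinear form on \<open>\<ell>\<^bsup>4/3\<^esup> \<times> \<ell>\<^bsup>4/3\<^esup>\<close>. The term
  \<open>2l/(1 - l)\<close> bounds the row sums of \<open>l\<^bsup>\<bar>i-j\<bar>\<^esup>\<close> off the diagonal. What matters is that the excess
  over 1 has order \<open>l\<^sup>4\<close>, that is \<open>1/p\<close>.
\<close>

definition kernel_norm_bound :: "real \<Rightarrow> real \<Rightarrow> real" where
  "kernel_norm_bound c l = 1 + 64 * (3 * c * (2 * l / (1 - l))) ^ 4"

text \<open>
  Young's inequality for the conjugate exponents \<open>4/3\<close> and \<open>4\<close>.
\<close>

lemma cube_absorbed_by_fourth_power:
  fixes E \<delta> :: real
  assumes "0 \<le> E" "0 \<le> \<delta>"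
  shows "E * \<delta> ^ 3 \<le> \<delta> ^ 4 / 4 + 64 * E ^ 4"
proof (cases "E \<le> \<delta> / 4")
  case True
  then have "E * \<delta> ^ 3 \<le> (\<delta> / 4) * \<delta> ^ 3"
    using assms by (intro mult_right_mono) auto
  also have "\<dots> = \<delta> ^ 4 / 4" by (simp add: eval_nat_numeral)
  finally show ?thesis using assms by (simp add: add_increasing2)
next
  case False
  then have "E * \<delta> ^ 3 \<le> E * (4 * E) ^ 3"
    using assms by (intro mult_left_mono power_mono) auto
  also have "\<dots> = 64 * E ^ 4" by (simp add: eval_nat_numeral)
  finally show ?thesis by (simp add: add_increasing)
qed

text \<open>
  When almost all the mass of both sequences sits at the same index \<open>i0\<close>, every off-diagonal term
  contains an entry away from \<open>i0\<close>, which is at most \<open>\<delta>\<close>. This gives the factor \<open>\<delta>\<^sup>3\<close>; the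
  row sums of the kernel do the rest.
\<close>

lemma off_diagonal_sum_le:
  fixes x y :: "nat \<Rightarrow> real"
  assumes l: "0 \<le> l" "l < 1" and I: "finite I" "i0 \<in> I"
    and x: "\<And>i. 0 \<le> x i" and y: "\<And>i. 0 \<le> y i" and xy0: "x i0 \<le> 1" "y i0 \<le> 1"
    and \<delta>: "0 \<le> \<delta>" "\<delta> \<le> 1"
    and xs: "(\<Sum>i\<in>I - {i0}. x i ^ 4) \<le> \<delta> ^ 4"
    and ys: "(\<Sum>i\<in>I - {i0}. y i ^ 4) \<le> \<delta> ^ 4"
  shows "(\<Sum>i\<in>I. \<Sum>j\<in>I - {i}. l ^ ((i - j) + (j - i)) * (x i ^ 3 * y j ^ 3))
    \<le> 3 * (2 * l / (1 - l)) * \<delta> ^ 3"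
proof -
  define W where "W = 2 * l / (1 - l)"
  define w where "w i j = l ^ ((i - j) + (j - i))" for i j :: nat
  define J where "J = I - {i0}"
  have w_sym: "w i j = w j i" and w0: "0 \<le> w i j" for i j
    using l by (auto simp: w_def add.commute)
  have row: "(\<Sum>j\<in>I' - {i}. w i j) \<le> W" if "finite I'" for I' i
    unfolding w_def W_def using sum_power_distance_le[OF l that] .
  have W0: "0 \<le> W" using l by (simp add: W_def)
  have J: "finite J" using I by (simp add: J_def)
  have le_\<delta>: "z j \<le> \<delta>" if "j \<in> J" "\<And>i. 0 \<le> z i" "(\<Sum>i\<in>J. z i ^ 4) \<le> \<delta> ^ 4"
    for j and z :: "nat \<Rightarrow> real"
  proof -
    have "z j ^ 4 \<le> (\<Sum>i\<in>J. z i ^ 4)"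
      using that J by (intro member_le_sum) auto
    with that(3) have "z j ^ 4 \<le> \<delta> ^ 4" by linarith
    then show ?thesis using that(2) \<delta> by (simp add: power_mono_iff)
  qed
  have x\<delta>: "x j \<le> \<delta>" and y\<delta>: "y j \<le> \<delta>" if "j \<in> J" for j
    using le_\<delta>[OF that x] le_\<delta>[OF that y] xs ys by (auto simp: J_def)
  have one: "(\<Sum>j\<in>J. w i0 j * z j ^ 3) \<le> W * \<delta> ^ 3"
    if "\<And>i. 0 \<le> z i" "\<And>j. j \<in> J \<Longrightarrow> z j \<le> \<delta>" for z
  proof -
    have "(\<Sum>j\<in>J. w i0 j * z j ^ 3) \<le> (\<Sum>j\<in>J. w i0 j * \<delta> ^ 3)"
      using that w0 by (intro sum_mono mult_left_mono power_mono) auto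
    also have "\<dots> = (\<Sum>j\<in>J. w i0 j) * \<delta> ^ 3" by (simp add: sum_distrib_right)
    also have "\<dots> \<le> W * \<delta> ^ 3"
      using row[OF I(1), of i0] \<delta> by (intro mult_right_mono) (auto simp: J_def)
    finally show ?thesis .
  qed
  have A: "(\<Sum>j\<in>J. w i0 j * (x i0 ^ 3 * y j ^ 3)) \<le> W * \<delta> ^ 3"
  proof -
    have "(\<Sum>j\<in>J. w i0 j * (x i0 ^ 3 * y j ^ 3)) \<le> (\<Sum>j\<in>J. w i0 j * (1 * y j ^ 3))"
      using x y xy0 w0 by (intro sum_mono mult_left_mono mult_right_mono power_le_one) auto
    then show ?thesis using one[of y] y y\<delta> by simp
  qed
  have B: "(\<Sum>i\<in>J. w i i0 * (x i ^ 3 * y i0 ^ 3)) \<le> W * \<delta> ^ 3"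
  proof -
    have "(\<Sum>i\<in>J. w i i0 * (x i ^ 3 * y i0 ^ 3)) \<le> (\<Sum>i\<in>J. w i i0 * (x i ^ 3 * 1))"
      using x y xy0 w0 by (intro sum_mono mult_left_mono power_le_one) auto
    then show ?thesis using one[of x] x x\<delta> by (simp add: w_sym[of _ i0])
  qed
  have C: "(\<Sum>i\<in>J. \<Sum>j\<in>J - {i}. w i j * (x i ^ 3 * y j ^ 3)) \<le> W * \<delta> ^ 3"
  proof -
    have pt: "x i ^ 3 * y j ^ 3 \<le> \<delta>\<^sup>2 * ((x i ^ 4 + y j ^ 4) / 2)" if "i \<in> J" "j \<in> J" for i j
    proof -
      have "x i ^ 3 * y j ^ 3 = (x i * y j) * ((x i)\<^sup>2 * (y j)\<^sup>2)"
        by (simp add: eval_nat_numeral)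
      \<comment> \<open>Both entries are away from the main index, so a factor \<open>\<delta>\<^sup>2\<close> may be taken out; the remaining
        squares are turned into fourth powers, whose sums are again at most \<open>\<delta>\<^sup>4\<close>.\<close>
      also have "\<dots> \<le> (\<delta> * \<delta>) * ((x i)\<^sup>2 * (y j)\<^sup>2)"
        using that x y x\<delta> y\<delta> \<delta> by (intro mult_right_mono mult_mono) auto
      also have "(x i)\<^sup>2 * (y j)\<^sup>2 \<le> (x i ^ 4 + y j ^ 4) / 2"
        using sum_squares_bound[of "(x i)\<^sup>2" "(y j)\<^sup>2"] by simp
      finally show ?thesis using \<delta> by (simp add: power2_eq_square mult_left_mono)
    qed
    have "(\<Sum>i\<in>J. \<Sum>j\<in>J - {i}. w i j * (x i ^ 3 * y j ^ 3))
        \<le> (\<Sum>i\<in>J. \<Sum>j\<in>J - {i}. w i j * (\<delta>\<^sup>2 * ((x i ^ 4 + y j ^ 4) / 2)))"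
      using w0 pt by (intro sum_mono mult_left_mono) auto
    also have "\<dots> = \<delta>\<^sup>2 / 2 * ((\<Sum>i\<in>J. \<Sum>j\<in>J - {i}. w i j * x i ^ 4)
        + (\<Sum>i\<in>J. \<Sum>j\<in>J - {i}. w i j * y j ^ 4))"
      by (simp add: sum.distrib[symmetric] sum_distrib_left algebra_simps add_divide_distrib)
    also have "(\<Sum>i\<in>J. \<Sum>j\<in>J - {i}. w i j * y j ^ 4) = (\<Sum>i\<in>J. \<Sum>j\<in>J - {i}. w i j * y i ^ 4)"
    proof -
      have "(\<Sum>i\<in>J. \<Sum>j\<in>J - {i}. w i j * y j ^ 4) = (\<Sum>i\<in>J. \<Sum>j\<in>{j\<in>J. j \<noteq> i}. w i j * y j ^ 4)"
        by (intro sum.cong) auto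
      also have "\<dots> = (\<Sum>j\<in>J. \<Sum>i\<in>{i\<in>J. j \<noteq> i}. w i j * y j ^ 4)"
        using J by (intro sum.swap_restrict) auto
      also have "\<dots> = (\<Sum>j\<in>J. \<Sum>i\<in>J - {j}. w j i * y j ^ 4)"
        by (intro sum.cong) (auto intro: arg_cong2[where f="(*)"] w_sym)
      finally show ?thesis .
    qed
    also have "\<delta>\<^sup>2 / 2 * ((\<Sum>i\<in>J. \<Sum>j\<in>J - {i}. w i j * x i ^ 4) + (\<Sum>i\<in>J. \<Sum>j\<in>J - {i}. w i j * y i ^ 4))
        \<le> \<delta>\<^sup>2 / 2 * (W * \<delta> ^ 4 + W * \<delta> ^ 4)"
    proof -
      have "(\<Sum>i\<in>J. \<Sum>j\<in>J - {i}. w i j * z i ^ 4) \<le> W * \<delta> ^ 4"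
        if "(\<Sum>i\<in>J. z i ^ 4) \<le> \<delta> ^ 4" for z
      proof -
        have "(\<Sum>i\<in>J. \<Sum>j\<in>J - {i}. w i j * z i ^ 4) \<le> (\<Sum>i\<in>J. W * z i ^ 4)"
          using row[OF J] by (intro sum_mono) (auto simp: sum_distrib_right[symmetric] intro!: mult_right_mono)
        also have "\<dots> = W * (\<Sum>i\<in>J. z i ^ 4)" by (simp add: sum_distrib_left)
        also have "\<dots> \<le> W * \<delta> ^ 4" using that W0 by (intro mult_left_mono) auto
        finally show ?thesis .
      qed
      then show ?thesis using xs ys by (intro mult_left_mono add_mono) (auto simp: J_def)
    qed
    also have "\<dots> = W * \<delta> ^ 6" by (simp add: eval_nat_numeral)
    also have "\<dots> \<le> W * \<delta> ^ 3"
      using W0 \<delta> by (intro mult_left_mono power_decreasing) auto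
    finally show ?thesis .
  qed
  have "(\<Sum>i\<in>I. \<Sum>j\<in>I - {i}. w i j * (x i ^ 3 * y j ^ 3))
      = (\<Sum>j\<in>J. w i0 j * (x i0 ^ 3 * y j ^ 3)) + (\<Sum>i\<in>J. \<Sum>j\<in>I - {i}. w i j * (x i ^ 3 * y j ^ 3))"
    unfolding J_def using I by (simp add: sum.remove)
  also have "(\<Sum>i\<in>J. \<Sum>j\<in>I - {i}. w i j * (x i ^ 3 * y j ^ 3))
      = (\<Sum>i\<in>J. w i i0 * (x i ^ 3 * y i0 ^ 3) + (\<Sum>j\<in>J - {i}. w i j * (x i ^ 3 * y j ^ 3)))"
  proof (rule sum.cong[OF refl])
    fix i assume "i \<in> J"
    then have "I - {i} - {i0} = J - {i}" "i0 \<in> I - {i}" using I by (auto simp: J_def)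
    then show "(\<Sum>j\<in>I - {i}. w i j * (x i ^ 3 * y j ^ 3))
        = w i i0 * (x i ^ 3 * y i0 ^ 3) + (\<Sum>j\<in>J - {i}. w i j * (x i ^ 3 * y j ^ 3))"
      using I by (simp add: sum.remove[of "I - {i}" i0])
  qed
  finally have "(\<Sum>i\<in>I. \<Sum>j\<in>I - {i}. w i j * (x i ^ 3 * y j ^ 3)) \<le> 3 * (W * \<delta> ^ 3)"
    using A B C by (simp add: sum.distrib)
  then show ?thesis by (simp add: w_def W_def mult.assoc)
qed

text \<open>
  The diagonal alone contributes at most \<open>M = max x\<^sub>i y\<^sub>i \<le> 1\<close>, so it leaves a deficit of \<open>1 - M\<close>.
  If \<open>M\<close> is close to 1 then both sequences concentrate at the maximising index, with mass at most
  \<open>\<delta>\<^sup>4 = 1 - M\<^sup>4 \<le> 4 (1 - M)\<close> elsewhere. The off-diagonal part is thus \<open>O(l \<delta>\<^sup>3)\<close>, and Young's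
  inequality splits this into \<open>\<delta>\<^sup>4/4\<close>, paid for by the deficit, and a term \<open>O(l\<^sup>4)\<close>.
  Writing the sequences as cubes \<open>x\<^sub>i\<^sup>3\<close> turns the \<open>\<ell>\<^bsup>4/3\<^esup>\<close>-norm into a sum of fourth powers.
\<close>

lemma exponent_kernel_bound_normalised:
  fixes x y :: "nat \<Rightarrow> real"
  assumes l: "0 \<le> l" "l < 1" and c: "0 \<le> c" and I: "finite I"
    and x: "\<And>i. 0 \<le> x i" and y: "\<And>i. 0 \<le> y i"
    and sx: "(\<Sum>i\<in>I. x i ^ 4) = 1" and sy: "(\<Sum>i\<in>I. y i ^ 4) = 1"
  shows "(\<Sum>i\<in>I. \<Sum>j\<in>I. exponent_kernel c l i j * (x i ^ 3 * y j ^ 3)) \<le> kernel_norm_bound c l"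
proof -
  have "I \<noteq> {}" using sx by auto
  with I have "Max ((\<lambda>i. x i * y i) ` I) \<in> (\<lambda>i. x i * y i) ` I" by (intro Max_in) auto
  then obtain i0 where i0: "i0 \<in> I" and eq: "x i0 * y i0 = Max ((\<lambda>i. x i * y i) ` I)" by force
  have max: "x i * y i \<le> x i0 * y i0" if "i \<in> I" for i
    unfolding eq using that I by (intro Max_ge) auto
  define M where "M = x i0 * y i0"
  have le1: "z i \<le> 1" if "\<And>i. 0 \<le> z i" "(\<Sum>i\<in>I. z i ^ 4) = 1" "i \<in> I"
    for i and z :: "nat \<Rightarrow> real"
  proof -
    have "z i ^ 4 \<le> (\<Sum>i\<in>I. z i ^ 4)" using that I by (intro member_le_sum) auto
    then show ?thesis using that by (simp add: power_le_one_iff)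
  qed
  have x1: "x i0 \<le> 1" and y1: "y i0 \<le> 1" using le1[of x] le1[of y] x y sx sy i0 by auto
  have M: "0 \<le> M" "M \<le> 1" "M \<le> x i0" "M \<le> y i0"
    using x y x1 y1 by (auto simp: M_def mult_le_one mult_left_le mult_left_le_one_le)
  define \<delta> where "\<delta> = root 4 (1 - M ^ 4)"
  have M4: "M ^ 4 \<le> 1" using M by (simp add: power_le_one)
  have \<delta>4: "\<delta> ^ 4 = 1 - M ^ 4" using M4 by (simp add: \<delta>_def)
  have \<delta>0: "0 \<le> \<delta>" using M4 by (simp add: \<delta>_def)
  have \<delta>1: "\<delta> \<le> 1"
  proof -
    have "\<delta> ^ 4 \<le> 1" using \<delta>4 M by simp
    then show ?thesis using \<delta>0 by (simp add: power_le_one_iff)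
  qed
  have rest: "(\<Sum>i\<in>I - {i0}. z i ^ 4) \<le> \<delta> ^ 4"
    if "\<And>i. 0 \<le> z i" "(\<Sum>i\<in>I. z i ^ 4) = 1" "M \<le> z i0" for z :: "nat \<Rightarrow> real"
  proof -
    have "M ^ 4 \<le> z i0 ^ 4" using that M by (intro power_mono) auto
    then show ?thesis using that(2) I i0 by (simp add: \<delta>4 sum.remove)
  qed
  have diag: "(\<Sum>i\<in>I. x i ^ 3 * y i ^ 3) \<le> M"
  proof -
    have "(\<Sum>i\<in>I. x i ^ 3 * y i ^ 3) \<le> (\<Sum>i\<in>I. M * ((x i ^ 4 + y i ^ 4) / 2))"
    proof (rule sum_mono)
      fix i assume i: "i \<in> I"
      have "x i ^ 3 * y i ^ 3 = (x i * y i) * ((x i)\<^sup>2 * (y i)\<^sup>2)" by (simp add: eval_nat_numeral)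
      also have "\<dots> \<le> M * ((x i)\<^sup>2 * (y i)\<^sup>2)"
        using max[OF i] by (intro mult_right_mono) (auto simp: M_def)
      also have "(x i)\<^sup>2 * (y i)\<^sup>2 \<le> (x i ^ 4 + y i ^ 4) / 2"
        using sum_squares_bound[of "(x i)\<^sup>2" "(y i)\<^sup>2"] by simp
      finally show "x i ^ 3 * y i ^ 3 \<le> M * ((x i ^ 4 + y i ^ 4) / 2)"
        using M by (simp add: mult_left_mono)
    qed
    also have "\<dots> = M * (((\<Sum>i\<in>I. x i ^ 4) + (\<Sum>i\<in>I. y i ^ 4)) / 2)"
      by (simp add: sum.distrib[symmetric] sum_distrib_left sum_divide_distrib)
    finally show ?thesis using sx sy by simp
  qed
  define E where "E = 3 * c * (2 * l / (1 - l))"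
  have E0: "0 \<le> E" using c l by (simp add: E_def)
  have "(\<Sum>i\<in>I. \<Sum>j\<in>I. exponent_kernel c l i j * (x i ^ 3 * y j ^ 3))
      = (\<Sum>i\<in>I. x i ^ 3 * y i ^ 3)
        + c * (\<Sum>i\<in>I. \<Sum>j\<in>I - {i}. l ^ ((i - j) + (j - i)) * (x i ^ 3 * y j ^ 3))"
  proof -
    have "(\<Sum>j\<in>I. exponent_kernel c l i j * (x i ^ 3 * y j ^ 3))
        = x i ^ 3 * y i ^ 3 + c * (\<Sum>j\<in>I - {i}. l ^ ((i - j) + (j - i)) * (x i ^ 3 * y j ^ 3))"
      if "i \<in> I" for i
      unfolding sum.remove[OF I that] sum_distrib_left
      by (intro arg_cong2[where f="(+)"] sum.cong) (auto simp: exponent_kernel_def)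
    then show ?thesis by (simp add: sum.distrib sum_distrib_left)
  qed
  also have "\<dots> \<le> M + c * (3 * (2 * l / (1 - l)) * \<delta> ^ 3)"
    using diag c off_diagonal_sum_le[OF l I i0 x y x1 y1 \<delta>0 \<delta>1 rest[OF x sx M(3)] rest[OF y sy M(4)]]
    by (intro add_mono mult_left_mono) auto
  also have "\<dots> = M + E * \<delta> ^ 3" by (simp add: E_def)
  also have "\<dots> \<le> M + (\<delta> ^ 4 / 4 + 64 * E ^ 4)"
    using cube_absorbed_by_fourth_power[OF E0 \<delta>0] by simp
  also have "\<delta> ^ 4 / 4 \<le> 1 - M"
  proof -
    have "1 + real 4 * (M - 1) \<le> (1 + (M - 1)) ^ 4" using M by (intro Bernoulli_inequality) auto
    then show ?thesis by (simp add: \<delta>4)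
  qed
  finally show ?thesis by (simp add: kernel_norm_bound_def E_def)
qed

lemma exponent_kernel_bound:
  fixes x y :: "nat \<Rightarrow> real"
  assumes l: "0 \<le> l" "l < 1" and c: "0 \<le> c" and I: "finite I"
    and x: "\<And>i. 0 \<le> x i" and y: "\<And>i. 0 \<le> y i"
    and X: "0 \<le> X" "(\<Sum>i\<in>I. x i ^ 4) = X ^ 4" and Y: "0 \<le> Y" "(\<Sum>i\<in>I. y i ^ 4) = Y ^ 4"
  shows "(\<Sum>i\<in>I. \<Sum>j\<in>I. exponent_kernel c l i j * (x i ^ 3 * y j ^ 3))
    \<le> kernel_norm_bound c l * (X ^ 3 * Y ^ 3)"
proof (cases "X = 0 \<or> Y = 0")
  case True
  then have "(\<Sum>i\<in>I. x i ^ 4) = 0 \<or> (\<Sum>i\<in>I. y i ^ 4) = 0" using X Y by auto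
  then have "(\<forall>i\<in>I. x i = 0) \<or> (\<forall>i\<in>I. y i = 0)"
    using I by (auto simp: sum_nonneg_eq_0_iff)
  then have "(\<Sum>i\<in>I. \<Sum>j\<in>I. exponent_kernel c l i j * (x i ^ 3 * y j ^ 3)) = 0"
    by (auto intro!: sum.neutral)
  then show ?thesis using True by auto
next
  case False
  then have pos: "0 < X" "0 < Y" using X Y by auto
  have "(\<Sum>i\<in>I. \<Sum>j\<in>I. exponent_kernel c l i j * ((x i / X) ^ 3 * (y j / Y) ^ 3)) \<le> kernel_norm_bound c l"
    using pos x y X Y
    by (intro exponent_kernel_bound_normalised[OF l c I]) (auto simp: power_divide sum_divide_distrib[symmetric])
  moreover have "(\<Sum>i\<in>I. \<Sum>j\<in>I. exponent_kernel c l i j * ((x i / X) ^ 3 * (y j / Y) ^ 3))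
      = (\<Sum>i\<in>I. \<Sum>j\<in>I. exponent_kernel c l i j * (x i ^ 3 * y j ^ 3)) / (X ^ 3 * Y ^ 3)"
    by (simp add: power_divide sum_divide_distrib)
  ultimately show ?thesis using pos by (simp add: pos_divide_le_eq)
qed

section \<open>Products over primes\<close>

text \<open>
  Norms of bilinear forms on \<open>\<ell>\<^bsup>4/3\<^esup>\<close> multiply under tensor products. For characteristic functions
  of finite sets this is an induction on the set of primes: split both sets by the exponent of one
  prime, apply the induction hypothesis to each pair of classes, and observe that the resulting
  sum is the one-prime form at the fourth roots of the class sizes. Since elements are
  only assumed to be determined by their exponents at the primes in \<open>P\<close>, the classes satisfy
  the same assumption for the smaller set of primes, and no prime has to be divided out.
\<close>

lemma tensorised_kernel_bound:
  fixes v :: "'a \<Rightarrow> 'p \<Rightarrow> nat" and c l :: "'p \<Rightarrow> real"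
  assumes "finite P"
    and "\<And>p. p \<in> P \<Longrightarrow> 0 \<le> c p" "\<And>p. p \<in> P \<Longrightarrow> 0 \<le> l p" "\<And>p. p \<in> P \<Longrightarrow> l p < 1"
    and "finite A" "finite B"
    and "\<And>a a'. a \<in> A \<Longrightarrow> a' \<in> A \<Longrightarrow> (\<And>p. p \<in> P \<Longrightarrow> v a p = v a' p) \<Longrightarrow> a = a'"
    and "\<And>b b'. b \<in> B \<Longrightarrow> b' \<in> B \<Longrightarrow> (\<And>p. p \<in> P \<Longrightarrow> v b p = v b' p) \<Longrightarrow> b = b'"
  shows "(\<Sum>a\<in>A. \<Sum>b\<in>B. \<Prod>p\<in>P. exponent_kernel (c p) (l p) (v a p) (v b p))
    \<le> (\<Prod>p\<in>P. kernel_norm_bound (c p) (l p)) * (root 4 (card A) ^ 3 * root 4 (card B) ^ 3)"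
  using assms
proof (induction P arbitrary: A B rule: finite_induct)
  case empty
  have small: "C = {} \<or> (\<exists>a. C = {a})" if "\<And>a a'. a \<in> C \<Longrightarrow> a' \<in> C \<Longrightarrow> a = a'" for C :: "'a set"
    using that by blast
  have "A = {} \<or> (\<exists>a. A = {a})" "B = {} \<or> (\<exists>b. B = {b})"
    using empty.prems(6,7) by (intro small; simp)+
  then show ?case by auto
next
  case (insert q P)
  define I where "I = (\<lambda>a. v a q) ` A \<union> (\<lambda>b. v b q) ` B"
  define A' where "A' i = {a\<in>A. v a q = i}" for i
  define B' where "B' i = {b\<in>B. v b q = i}" for i
  define K where "K a b = (\<Prod>p\<in>P. exponent_kernel (c p) (l p) (v a p) (v b p))" for a b
  define N where "N = (\<Prod>p\<in>P. kernel_norm_bound (c p) (l p))"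
  \<comment> \<open>Fourth roots, so that the sum of fourth powers over all classes is the cardinality of the whole set.\<close>
  define x where "x i = root 4 (card (A' i))" for i
  define y where "y i = root 4 (card (B' i))" for i
  have fin: "finite A" "finite B" "finite I" using insert.prems by (auto simp: I_def)
  have group: "(\<Sum>a\<in>C. f a) = (\<Sum>i\<in>I. \<Sum>a\<in>{a\<in>C. v a q = i}. f a)"
    if "finite C" "(\<lambda>a. v a q) ` C \<subseteq> I" for C and f :: "'a \<Rightarrow> real"
    using that fin by (intro sum.group[symmetric]) auto
  have N0: "0 \<le> N" by (auto simp: N_def kernel_norm_bound_def intro!: prod_nonneg)
  have IH: "(\<Sum>a\<in>A' i. \<Sum>b\<in>B' j. K a b) \<le> N * (x i ^ 3 * y j ^ 3)" for i j
    unfolding K_def N_def x_def y_def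
  proof (rule insert.IH)
    show "a = a'" if "a \<in> A' i" "a' \<in> A' i" "\<And>p. p \<in> P \<Longrightarrow> v a p = v a' p" for a a'
      using that by (intro insert.prems(6)) (auto simp: A'_def)
    show "b = b'" if "b \<in> B' j" "b' \<in> B' j" "\<And>p. p \<in> P \<Longrightarrow> v b p = v b' p" for b b'
      using that by (intro insert.prems(7)) (auto simp: B'_def)
  qed (use insert.prems in \<open>auto simp: A'_def B'_def\<close>)
  have "(\<Sum>a\<in>A. \<Sum>b\<in>B. \<Prod>p\<in>insert q P. exponent_kernel (c p) (l p) (v a p) (v b p))
      = (\<Sum>a\<in>A. \<Sum>b\<in>B. exponent_kernel (c q) (l q) (v a q) (v b q) * K a b)"
    using insert.hyps by (simp add: K_def)
  also have "\<dots> = (\<Sum>i\<in>I. \<Sum>a\<in>A' i. \<Sum>j\<in>I. \<Sum>b\<in>B' j. exponent_kernel (c q) (l q) (v a q) (v b q) * K a b)"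
    unfolding A'_def B'_def by (subst group[of A], simp add: fin, simp add: I_def, subst group[of B]) (auto simp: fin I_def)
  also have "\<dots> = (\<Sum>i\<in>I. \<Sum>a\<in>A' i. \<Sum>j\<in>I. \<Sum>b\<in>B' j. exponent_kernel (c q) (l q) i j * K a b)"
    by (intro sum.cong refl) (auto simp: A'_def B'_def)
  also have "\<dots> = (\<Sum>i\<in>I. \<Sum>j\<in>I. \<Sum>a\<in>A' i. \<Sum>b\<in>B' j. exponent_kernel (c q) (l q) i j * K a b)"
    by (intro sum.cong refl sum.swap)
  also have "\<dots> = (\<Sum>i\<in>I. \<Sum>j\<in>I. exponent_kernel (c q) (l q) i j * (\<Sum>a\<in>A' i. \<Sum>b\<in>B' j. K a b))"
    by (simp add: sum_distrib_left)
  also have "\<dots> \<le> (\<Sum>i\<in>I. \<Sum>j\<in>I. exponent_kernel (c q) (l q) i j * (N * (x i ^ 3 * y j ^ 3)))"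
    using insert.prems by (intro sum_mono mult_left_mono IH) (auto simp: exponent_kernel_def)
  also have "\<dots> = N * (\<Sum>i\<in>I. \<Sum>j\<in>I. exponent_kernel (c q) (l q) i j * (x i ^ 3 * y j ^ 3))"
    by (simp add: sum_distrib_left mult_ac)
  also have "\<dots> \<le> N * (kernel_norm_bound (c q) (l q) * (root 4 (card A) ^ 3 * root 4 (card B) ^ 3))"
  proof (intro mult_left_mono N0 exponent_kernel_bound)
    show "(\<Sum>i\<in>I. x i ^ 4) = root 4 (card A) ^ 4"
      using group[of A "\<lambda>_. 1"] fin by (simp add: x_def A'_def I_def)
    show "(\<Sum>i\<in>I. y i ^ 4) = root 4 (card B) ^ 4"
      using group[of B "\<lambda>_. 1"] fin by (simp add: y_def B'_def I_def)
  qed (use insert.prems fin in \<open>auto simp: x_def y_def\<close>)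
  finally show ?case using insert.hyps by (simp add: N_def mult_ac)
qed

section \<open>Reciprocals of primes\<close>

lemma prime_dvd_central_binomial:
  fixes p n :: nat
  assumes "prime p" "n < p" "p \<le> 2 * n"
  shows "p dvd (2 * n) choose n"
proof -
  have "fact n * fact n * ((2 * n) choose n) = (fact (2 * n) :: nat)"
    using binomial_fact_lemma[of n "2 * n"] by simp
  moreover have "p dvd fact (2 * n)" "\<not> p dvd fact n"
    using assms by (auto simp: prime_dvd_fact_iff)
  ultimately show ?thesis
    using assms(1) by (metis prime_dvd_mult_iff)
qed

lemma prod_primes_dvd:
  fixes n :: nat
  assumes "finite P" "\<And>p. p \<in> P \<Longrightarrow> prime p" "\<And>p. p \<in> P \<Longrightarrow> p dvd n"
  shows "\<Prod>P dvd n"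
  using assms
proof (induction P rule: finite_induct)
  case (insert p P)
  have "coprime p (\<Prod>P)"
    using insert by (intro prod_coprime_right) (auto intro: primes_coprime)
  then show ?case
    using insert by (auto intro: divides_mult)
qed simp

text \<open>
  All primes between \<open>n\<close> and \<open>2n\<close> divide the central binomial coefficient, which is at most \<open>4\<^sup>n\<close>.
\<close>

lemma power_card_primes_le:
  fixes n :: nat
  shows "n ^ card {p. prime p \<and> n < p \<and> p \<le> 2 * n} \<le> 4 ^ n"
proof -
  define P where "P = {p. prime p \<and> n < p \<and> p \<le> 2 * n}"
  have fin: "finite P" unfolding P_def by (rule finite_subset[of _ "{..2 * n}"]) auto
  have "n ^ card P = (\<Prod>p\<in>P. n)" by simp
  also have "\<dots> \<le> \<Prod>P" by (rule prod_mono) (auto simp: P_def)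
  also have "\<dots> \<le> (2 * n) choose n"
    by (intro dvd_imp_le prod_primes_dvd fin) (auto simp: P_def prime_dvd_central_binomial)
  also have "\<dots> \<le> (\<Sum>k\<le>2 * n. (2 * n) choose k)"
    by (rule member_le_sum) auto
  also have "\<dots> = 4 ^ n" by (simp add: choose_row_sum power_mult)
  finally show ?thesis by (simp add: P_def)
qed

lemma sum_inverse_primes_dyadic:
  assumes "1 \<le> J"
  shows "(\<Sum>p | prime p \<and> 2 ^ J < p \<and> p \<le> 2 ^ Suc J. 1 / real p) \<le> 2 / real J"
proof -
  define P where "P = {p::nat. prime p \<and> 2 ^ J < p \<and> p \<le> 2 ^ Suc J}"
  have "(2::nat) ^ (J * card P) \<le> 2 ^ (2 * 2 ^ J)"
    using power_card_primes_le[of "2 ^ J"] by (simp add: P_def power_mult)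
  then have "J * card P \<le> 2 * 2 ^ J" by simp
  then have "real (J * card P) \<le> real (2 * 2 ^ J)" by (rule of_nat_mono)
  then have card: "real J * real (card P) \<le> 2 * 2 ^ J" by simp
  have "(\<Sum>p\<in>P. 1 / real p) \<le> (\<Sum>p\<in>P. 1 / 2 ^ J)"
  proof (intro sum_mono divide_left_mono)
    fix p assume "p \<in> P"
    then have "2 ^ J \<le> p" by (simp add: P_def)
    then have "real (2 ^ J) \<le> real p" by (rule of_nat_mono)
    then show "2 ^ J \<le> real p" by simp
    then show "0 < real p * 2 ^ J" by (intro mult_pos_pos) (auto intro: less_le_trans[rotated])
  qed simp
  also have "\<dots> = real (card P) / 2 ^ J" by simp
  also have "\<dots> \<le> 2 / real J" using card assms by (simp add: field_simps)
  finally show ?thesis by (simp add: P_def)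
qed

text \<open>
  A weak form of Mertens' theorem, with \<open>4 log log\<close> in place of \<open>log log\<close>: the dyadic blocks
  contribute a multiple of the harmonic series. It is enough for the products
  \<open>\<Prod> (1 + H/p)\<close> to grow only like a power of a logarithm.
\<close>

lemma sum_inverse_primes_le:
  assumes "1 \<le> J"
  shows "(\<Sum>p | prime p \<and> p \<le> (2::nat) ^ J. 1 / real p) \<le> 1 + 4 * ln (real J)"
  using assms
proof (induction J rule: dec_induct)
  case base
  have "{p. prime p \<and> p \<le> (2::nat) ^ 1} = {2}"
  proof (intro equalityI subsetI)
    fix p :: nat assume "p \<in> {p. prime p \<and> p \<le> 2 ^ 1}"
    with prime_ge_2_nat[of p] show "p \<in> {2}" by simp
  qed simp
  then show ?case by simp
next
  case (step J)
  have split: "{p. prime p \<and> p \<le> (2::nat) ^ Suc J}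
      = {p. prime p \<and> p \<le> 2 ^ J} \<union> {p. prime p \<and> 2 ^ J < p \<and> p \<le> 2 ^ Suc J}"
    by auto
  have "(\<Sum>p | prime p \<and> p \<le> (2::nat) ^ Suc J. 1 / real p) = (\<Sum>p | prime p \<and> p \<le> (2::nat) ^ J. 1 / real p)
      + (\<Sum>p | prime p \<and> (2::nat) ^ J < p \<and> p \<le> 2 ^ Suc J. 1 / real p)"
    unfolding split
    by (rule sum.union_disjoint) (auto intro: finite_subset[of _ "{..2 ^ Suc J}"])
  also have "\<dots> \<le> (1 + 4 * ln (real J)) + 2 / real J"
    by (rule add_mono[OF step.IH sum_inverse_primes_dyadic[OF step.hyps(1)]])
  also have "2 / real J \<le> 4 * (ln (real (Suc J)) - ln (real J))"
  proof -
    have "ln (real J / real (Suc J)) \<le> real J / real (Suc J) - 1"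
      using step by (intro ln_le_minus_one) auto
    also have "\<dots> = - (1 / real (Suc J))" by (simp add: field_simps)
    also have "\<dots> \<le> - (1 / (2 * real J))"
      using step by (simp add: field_simps)
    finally show ?thesis using step by (simp add: ln_div field_simps)
  qed
  finally show ?case by simp
qed

section \<open>A weighted gcd sum\<close>

lemma multiplicity_coprime_quotient:
  fixes m n p :: nat
  assumes "prime p" "0 < m" "0 < n"
  shows "multiplicity p (m * n div (gcd m n)\<^sup>2)
    = (multiplicity p m - multiplicity p n) + (multiplicity p n - multiplicity p m)"
proof -
  define q where "q = m * n div (gcd m n)\<^sup>2"
  have "(gcd m n)\<^sup>2 dvd m * n" by (simp add: power2_eq_square mult_dvd_mono)
  then have q: "q * (gcd m n)\<^sup>2 = m * n" by (simp add: q_def)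
  then have "q \<noteq> 0" using assms by (auto intro!: Nat.gr0I)
  have "multiplicity p (q * (gcd m n)\<^sup>2) = multiplicity p q + 2 * multiplicity p (gcd m n)"
    using assms \<open>q \<noteq> 0\<close> by (simp add: prime_elem_multiplicity_mult_distrib prime_elem_multiplicity_power_distrib)
  moreover have "multiplicity p (m * n) = multiplicity p m + multiplicity p n"
    using assms by (simp add: prime_elem_multiplicity_mult_distrib)
  moreover have "multiplicity p (gcd m n) = min (multiplicity p m) (multiplicity p n)"
    using assms by (simp add: multiplicity_gcd)
  ultimately show ?thesis unfolding q[symmetric] using q by (simp add: q_def min_def split: if_splits)
qed

lemma prod_exponent_kernel_eq:
  fixes m n :: nat and c :: "nat \<Rightarrow> real"
  defines "q \<equiv> m * n div (gcd m n)\<^sup>2"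
  assumes mn: "0 < m" "0 < n" and P: "finite P" "\<And>p. p \<in> P \<Longrightarrow> prime p"
    and sub: "prime_factors m \<subseteq> P" "prime_factors n \<subseteq> P"
    and c: "\<And>p. p \<in> prime_factors q \<Longrightarrow> c p = 2"
  shows "(\<Prod>p\<in>P. exponent_kernel (c p) (root 4 (1 / real p)) (multiplicity p m) (multiplicity p n))
    = 2 ^ omega q * root 4 (1 / real q)"
proof -
  have dvd: "(gcd m n)\<^sup>2 dvd m * n" by (simp add: power2_eq_square mult_dvd_mono)
  then have qg: "q * (gcd m n)\<^sup>2 = m * n" by (simp add: q_def)
  then have q0: "q \<noteq> 0" using mn by (auto intro!: Nat.gr0I)
  have qP: "prime_factors q \<subseteq> P"
  proof
    fix p assume "p \<in> prime_factors q"
    then have p: "prime p" "p dvd m * n" unfolding qg[symmetric] by auto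
    then have "p dvd m \<or> p dvd n" by (simp add: prime_dvd_mult_iff)
    then show "p \<in> P" using p sub mn by (auto intro: prime_factorsI)
  qed
  have mult: "multiplicity p q = (multiplicity p m - multiplicity p n) + (multiplicity p n - multiplicity p m)"
    if "prime p" for p
    unfolding q_def using multiplicity_coprime_quotient[OF that mn] .
  have "(\<Prod>p\<in>P. exponent_kernel (c p) (root 4 (1 / real p)) (multiplicity p m) (multiplicity p n))
      = (\<Prod>p\<in>prime_factors q. exponent_kernel (c p) (root 4 (1 / real p)) (multiplicity p m) (multiplicity p n))"
  proof (rule prod.mono_neutral_right[OF P(1) qP], rule ballI)
    fix p assume p: "p \<in> P - prime_factors q"
    then have "multiplicity p q = 0"
      using P(2) q0 by (intro not_dvd_imp_multiplicity_0) (auto intro: prime_factorsI)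
    then show "exponent_kernel (c p) (root 4 (1 / real p)) (multiplicity p m) (multiplicity p n) = 1"
      using mult[of p] P(2) p by (simp add: exponent_kernel_def)
  qed
  also have "\<dots> = (\<Prod>p\<in>prime_factors q. 2 * root 4 (1 / real p ^ multiplicity p q))"
  proof (rule prod.cong[OF refl])
    fix p assume p: "p \<in> prime_factors q"
    then have "multiplicity p q \<noteq> 0" "prime p" unfolding prime_factors_multiplicity by auto
    then show "exponent_kernel (c p) (root 4 (1 / real p)) (multiplicity p m) (multiplicity p n)
        = 2 * root 4 (1 / real p ^ multiplicity p q)"
      using mult[of p] c[OF p] by (auto simp: exponent_kernel_def real_root_power power_one_over[symmetric])
  qed
  also have "\<dots> = 2 ^ omega q * root 4 (\<Prod>p\<in>prime_factors q. 1 / real p ^ multiplicity p q)"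
  proof -
    have "root 4 (\<Prod>p\<in>Q. f p) = (\<Prod>p\<in>Q. root 4 (f p))" if "finite Q" for Q and f :: "nat \<Rightarrow> real"
      using that by (induction Q rule: finite_induct) (auto simp: real_root_mult)
    then show ?thesis by (simp add: prod.distrib omega_def)
  qed
  also have "(\<Prod>p\<in>prime_factors q. 1 / real p ^ multiplicity p q) = 1 / real q"
  proof -
    have "real q = real (\<Prod>p\<in>prime_factors q. p ^ multiplicity p q)"
      using q0 by (simp add: prime_factorization_nat[symmetric])
    then show ?thesis by (simp add: prod_dividef)
  qed
  finally show ?thesis .
qed

text \<open>
  For every prime \<open>l = p\<^bsup>-1/4\<^esup> \<le> 2\<^bsup>-1/4\<^esup> \<le> 6/7\<close>, so the row sum \<open>2l/(1 - l)\<close> is at most \<open>14 l\<close>; this is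
  the origin of the constant \<open>84 = 3 \<cdot> 2 \<cdot> 14\<close>.
\<close>

lemma kernel_norm_bound_prime:
  assumes "prime p"
  shows "kernel_norm_bound 2 (root 4 (1 / real p)) \<le> exp (64 * 84 ^ 4 * (1 / real p))"
proof -
  define l where "l = root 4 (1 / real p)"
  have p: "2 \<le> real p" using prime_ge_2_nat[OF assms] by simp
  have l4: "l ^ 4 = 1 / real p" by (simp add: l_def)
  have l0: "0 \<le> l" by (simp add: l_def)
  have "l ^ 4 \<le> (6 / 7) ^ 4"
  proof -
    have "1 / real p \<le> 1 / 2" using p by (simp add: field_simps)
    also have "\<dots> \<le> (6 / 7 :: real) ^ 4" by (simp add: eval_nat_numeral)
    finally show ?thesis by (simp add: l4)
  qed
  then have l1: "l \<le> 6 / 7" using l0 by (simp only: power_mono_iff)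
  have "2 * l / (1 - l) \<le> 14 * l"
  proof -
    have "l * (7 * l) \<le> l * 6" using l0 l1 by (intro mult_left_mono) auto
    then show ?thesis using l1 by (simp add: pos_divide_le_eq algebra_simps)
  qed
  then have "(3 * 2 * (2 * l / (1 - l))) ^ 4 \<le> (84 * l) ^ 4"
    using l0 l1 by (intro power_mono) auto
  also have "\<dots> = 84 ^ 4 * (1 / real p)" by (simp only: power_mult_distrib l4)
  finally have "kernel_norm_bound 2 l \<le> 1 + 64 * 84 ^ 4 * (1 / real p)"
    by (simp add: kernel_norm_bound_def)
  also have "\<dots> \<le> exp (64 * 84 ^ 4 * (1 / real p))" by (rule exp_ge_add_one_self)
  finally show ?thesis by (simp add: l_def)
qed

text \<open>
  Without a bound on the primes of \<open>q\<close> the product of the local norms could involve every prime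
  factor of an element of \<open>A \<union> B\<close>. As only pairs whose \<open>q\<close> is composed of primes up to \<open>z\<close> are
  summed, the kernel of a larger prime may be replaced by the diagonal one (\<open>c = 0\<close>), whose norm is
  1, without changing the weight of these pairs.
\<close>

lemma weighted_gcd_sum_bound:
  fixes A B :: "nat set" and T :: "(nat \<times> nat) set" and z :: nat
  defines "q \<equiv> \<lambda>m n. m * n div (gcd m n)\<^sup>2"
  assumes fin: "finite A" "finite B" and pos: "0 \<notin> A" "0 \<notin> B" and T: "T \<subseteq> A \<times> B"
    and smooth: "\<And>m n p. (m, n) \<in> T \<Longrightarrow> p \<in> prime_factors (q m n) \<Longrightarrow> p \<le> z"
  shows "(\<Sum>(m, n)\<in>T. 2 ^ omega (q m n) * root 4 (1 / real (q m n)))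
    \<le> exp (64 * 84 ^ 4 * (\<Sum>p | prime p \<and> p \<le> z. 1 / real p))
      * (root 4 (card A) ^ 3 * root 4 (card B) ^ 3)"
proof -
  define P where "P = (\<Union>a\<in>A \<union> B. prime_factors a)"
  define c :: "nat \<Rightarrow> real" where "c p = (if p \<le> z then 2 else 0)" for p
  define l where "l p = root 4 (1 / real p)" for p :: nat
  define K where "K m n = (\<Prod>p\<in>P. exponent_kernel (c p) (l p) (multiplicity p m) (multiplicity p n))" for m n
  have P: "finite P" "\<And>p. p \<in> P \<Longrightarrow> prime p" using fin by (auto simp: P_def)
  have c0: "0 \<le> c p" and l0: "0 \<le> l p" for p by (auto simp: c_def l_def)
  have l1: "l p < 1" if "p \<in> P" for p
    using prime_ge_2_nat[OF P(2)[OF that]] by (simp add: l_def)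
  have K0: "0 \<le> K m n" for m n
    using c0 l0 by (auto simp: K_def exponent_kernel_def intro!: prod_nonneg)
  have inj: "a = a'" if "a \<in> A \<union> B" "a' \<in> A \<union> B" "\<And>p. p \<in> P \<Longrightarrow> multiplicity p a = multiplicity p a'" for a a'
  proof (rule multiplicity_eq_nat)
    show "0 < a" "0 < a'" using that pos by (auto intro!: Nat.gr0I)
    fix p :: nat assume p: "prime p"
    show "multiplicity p a = multiplicity p a'"
    proof (cases "p \<in> P")
      case False
      then have "p \<notin> prime_factors a" "p \<notin> prime_factors a'" using that by (auto simp: P_def)
      then show ?thesis using p by (simp add: prime_factors_multiplicity)
    qed (rule that)
  qed
  have "(\<Sum>(m, n)\<in>T. 2 ^ omega (q m n) * root 4 (1 / real (q m n))) = (\<Sum>(m, n)\<in>T. K m n)"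
  proof (rule sum.cong[OF refl], clarify)
    fix m n assume mn: "(m, n) \<in> T"
    then have "m \<in> A" "n \<in> B" using T by auto
    moreover from this have "0 < m" "0 < n" using pos by (auto intro!: Nat.gr0I)
    ultimately have "K m n = 2 ^ omega (q m n) * root 4 (1 / real (q m n))"
      unfolding K_def l_def q_def using smooth[OF mn] P
      by (intro prod_exponent_kernel_eq) (auto simp: P_def c_def q_def)
    then show "2 ^ omega (q m n) * root 4 (1 / real (q m n)) = K m n" by simp
  qed
  also have "\<dots> \<le> (\<Sum>(m, n)\<in>A \<times> B. K m n)"
    using T fin K0 by (intro sum_mono2) auto
  also have "\<dots> = (\<Sum>m\<in>A. \<Sum>n\<in>B. K m n)" by (simp add: sum.cartesian_product)
  also have "\<dots> \<le> (\<Prod>p\<in>P. kernel_norm_bound (c p) (l p)) * (root 4 (card A) ^ 3 * root 4 (card B) ^ 3)"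
    unfolding K_def
  proof (rule tensorised_kernel_bound)
    show "a = a'" if "a \<in> A" "a' \<in> A" "\<And>p. p \<in> P \<Longrightarrow> multiplicity p a = multiplicity p a'" for a a'
      by (rule inj) (use that in auto)
    show "b = b'" if "b \<in> B" "b' \<in> B" "\<And>p. p \<in> P \<Longrightarrow> multiplicity p b = multiplicity p b'" for b b'
      by (rule inj) (use that in auto)
  qed (use P fin c0 l0 l1 in auto)
  also have "\<dots> \<le> exp (64 * 84 ^ 4 * (\<Sum>p | prime p \<and> p \<le> z. 1 / real p))
      * (root 4 (card A) ^ 3 * root 4 (card B) ^ 3)"
  proof (rule mult_right_mono)
    have "(\<Prod>p\<in>P. kernel_norm_bound (c p) (l p)) = (\<Prod>p\<in>{p\<in>P. p \<le> z}. kernel_norm_bound (c p) (l p))"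
      using P(1) by (intro prod.mono_neutral_right) (auto simp: c_def kernel_norm_bound_def)
    also have "\<dots> \<le> (\<Prod>p\<in>{p\<in>P. p \<le> z}. exp (64 * 84 ^ 4 * (1 / real p)))"
      using kernel_norm_bound_prime P(2)
      by (intro prod_mono) (auto simp: c_def l_def kernel_norm_bound_def)
    also have "\<dots> = exp (64 * 84 ^ 4 * (\<Sum>p\<in>{p\<in>P. p \<le> z}. 1 / real p))"
      using P(1) by (simp add: exp_sum[symmetric] sum_distrib_left)
    also have "\<dots> \<le> exp (64 * 84 ^ 4 * (\<Sum>p | prime p \<and> p \<le> z. 1 / real p))"
    proof -
      have "(\<Sum>p\<in>{p\<in>P. p \<le> z}. 1 / real p) \<le> (\<Sum>p | prime p \<and> p \<le> z. 1 / real p)"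
        using P by (intro sum_mono2) (auto intro: finite_subset[of _ "{..z}"])
      then show ?thesis by simp
    qed
    finally show "(\<Prod>p\<in>P. kernel_norm_bound (c p) (l p))
      \<le> exp (64 * 84 ^ 4 * (\<Sum>p | prime p \<and> p \<le> z. 1 / real p))" .
  qed simp
  finally show ?thesis .
qed

section \<open>Pairs whose quotient has many prime factors\<close>

text \<open>
  A large gcd \<open>g\<close> leaves room only for small cofactors \<open>m/g\<close> and \<open>n/g\<close>, and \<open>q\<close> is their product.
\<close>

lemma coprime_quotient_bounds:
  fixes m n :: nat and N X :: real
  defines "q \<equiv> m * n div (gcd m n)\<^sup>2"
  assumes pos: "0 < m" "0 < n" "0 < X" and le: "real m \<le> N" "real n \<le> N"
    and gcd: "N / X \<le> real (gcd m n)"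
  shows "0 < q" "real q \<le> X\<^sup>2" "p \<in> prime_factors q \<Longrightarrow> real p \<le> X"
proof -
  define a b where "a = m div gcd m n" and "b = n div gcd m n"
  have q: "q = a * b"
    by (simp add: q_def a_def b_def power2_eq_square div_mult_div_if_dvd)
  have m: "m = gcd m n * a" and n: "n = gcd m n * b" by (simp_all add: a_def b_def)
  have g: "0 < gcd m n" using pos by simp
  have ab: "0 < a" "0 < b" using m n pos by (auto intro!: Nat.gr0I)
  then show "0 < q" by (simp add: q)
  have bound: "real c \<le> X" if "real (gcd m n * c) \<le> N" for c
  proof -
    have "real (gcd m n) * real c \<le> N" using that by simp
    also have "\<dots> \<le> real (gcd m n) * X" using gcd pos by (simp add: field_simps)
    finally show ?thesis using g by simp
  qed
  have aX: "real a \<le> X" and bX: "real b \<le> X" using le m n by (metis bound)+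
  then show "real q \<le> X\<^sup>2" using pos by (simp add: q power2_eq_square mult_mono)
  assume "p \<in> prime_factors q"
  then have "prime p" "p dvd a * b" by (auto simp: q)
  then have "p dvd a \<or> p dvd b" by (simp add: prime_dvd_mult_iff)
  then have "p \<le> a \<or> p \<le> b" using ab by (auto dest: dvd_imp_le)
  then show "real p \<le> X" using aX bX by auto
qed

text \<open>
  Rankin's trick: each pair counted has weight at least \<open>2\<^bsup>w\<^esup> X\<^bsup>-1/2\<^esup>\<close> in the weighted gcd sum,
  since \<open>q \<le> X\<^sup>2\<close> and \<open>\<omega>(q) \<ge> w\<close>. The primes of \<open>q\<close> are at most \<open>X \<le> 2\<^sup>J\<close>, so the upper bound for that sum
  involves only the primes up to \<open>2\<^sup>J\<close>.
\<close>

lemma card_pairs_many_primes_le: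
  fixes A B :: "nat set" and N X w :: real and J :: nat
  defines "q \<equiv> \<lambda>m n. m * n div (gcd m n)\<^sup>2"
  assumes fin: "finite A" "finite B" and pos: "0 \<notin> A" "0 \<notin> B"
    and N: "\<And>a. a \<in> A \<union> B \<Longrightarrow> real a \<le> N" and X: "0 < X" "X \<le> 2 ^ J" and J: "1 \<le> J"
  shows "real (card {(m, n). m \<in> A \<and> n \<in> B \<and> N / X \<le> real (gcd m n) \<and> w \<le> real (omega (q m n))})
      * (2 powr w * X powr (- 1/2))
    \<le> exp (64 * 84 ^ 4 * (1 + 4 * ln (real J)))
      * (real (card A) powr (3/4) * real (card B) powr (3/4))"
proof -
  define T where "T = {(m, n). m \<in> A \<and> n \<in> B \<and> N / X \<le> real (gcd m n) \<and> w \<le> real (omega (q m n))}"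
  have sub: "T \<subseteq> A \<times> B" by (auto simp: T_def)
  have bounds: "0 < q m n" "real (q m n) \<le> X\<^sup>2" "p \<in> prime_factors (q m n) \<Longrightarrow> real p \<le> X"
    if "(m, n) \<in> T" for m n p
  proof -
    have *: "0 < m" "0 < n" "real m \<le> N" "real n \<le> N" "N / X \<le> real (gcd m n)"
      using that N pos by (auto simp: T_def intro!: Nat.gr0I)
    show "0 < q m n" "real (q m n) \<le> X\<^sup>2" "p \<in> prime_factors (q m n) \<Longrightarrow> real p \<le> X"
      unfolding q_def using coprime_quotient_bounds[OF *(1,2) X(1) *(3-5)] by auto
  qed
  have cube: "root 4 (real c) ^ 3 = real c powr (3/4)" for c :: nat
    by (cases "c = 0") (simp_all add: root_powr_inverse powr_realpow[symmetric] powr_powr)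
  have "real (card T) * (2 powr w * X powr (- 1/2)) = (\<Sum>(m, n)\<in>T. 2 powr w * X powr (- 1/2))"
    by simp
  also have "\<dots> \<le> (\<Sum>(m, n)\<in>T. 2 ^ omega (q m n) * root 4 (1 / real (q m n)))"
  proof (rule sum_mono, clarify, rule mult_mono)
    fix m n assume mn: "(m, n) \<in> T"
    show "2 powr w \<le> (2::real) ^ omega (q m n)"
      using mn by (simp add: T_def powr_realpow[symmetric])
    have "X powr (- 1/2) = root 4 (1 / X\<^sup>2)"
    proof (rule real_root_pos_unique[symmetric])
      show "(X powr (- 1/2)) ^ 4 = 1 / X\<^sup>2" using X(1) by (simp add: powr_power powr_neg_numeral)
    qed auto
    also have "\<dots> \<le> root 4 (1 / real (q m n))"
      using bounds(1,2)[OF mn] X(1) by (simp add: frac_le)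
    finally show "X powr (- 1/2) \<le> root 4 (1 / real (q m n))" .
  qed auto
  also have "\<dots> \<le> exp (64 * 84 ^ 4 * (\<Sum>p | prime p \<and> p \<le> (2::nat) ^ J. 1 / real p))
      * (root 4 (card A) ^ 3 * root 4 (card B) ^ 3)"
    unfolding q_def
  proof (rule weighted_gcd_sum_bound[OF fin pos sub])
    fix m n p assume "(m, n) \<in> T" "p \<in> prime_factors (m * n div (gcd m n)\<^sup>2)"
    then have "real p \<le> X" using bounds(3) by (simp add: q_def)
    also note X(2)
    finally have "real p \<le> real (2 ^ J)" by simp
    then show "p \<le> 2 ^ J" by (simp only: of_nat_le_iff)
  qed
  also have "\<dots> \<le> exp (64 * 84 ^ 4 * (1 + 4 * ln (real J))) * (root 4 (card A) ^ 3 * root 4 (card B) ^ 3)"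
    using sum_inverse_primes_le[OF J] by (intro mult_right_mono) auto
  finally show ?thesis by (simp only: cube T_def)
qed

lemma eventually_log_small:
  fixes b :: real
  shows "\<exists>K::nat. \<forall>k\<ge>K. 5 \<le> ln (real k) \<and> b * ln (real k) \<le> real k * ln 2"
proof -
  have "((\<lambda>x::real. ln x / x) \<longlongrightarrow> 0) at_top" by (rule ln_x_over_x_tendsto_0)
  then have "((\<lambda>x::real. b * (ln x / x)) \<longlongrightarrow> b * 0) at_top" by (intro tendsto_mult tendsto_const)
  then have "eventually (\<lambda>x::real. b * (ln x / x) < ln 2) at_top"
    by (rule order_tendstoD) simp
  moreover have "eventually (\<lambda>x::real. 5 \<le> ln x) at_top"
    using ln_at_top by (simp add: filterlim_at_top)
  ultimately have "eventually (\<lambda>x::real. 5 \<le> ln x \<and> b * ln x \<le> x * ln 2) at_top"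
    using eventually_gt_at_top[of 0] by eventually_elim (simp add: field_simps)
  then have "eventually (\<lambda>k. 5 \<le> ln (real k) \<and> b * ln (real k) \<le> real k * ln 2) sequentially"
    using filterlim_real_sequentially by (rule eventually_compose_filterlim)
  then show ?thesis by (simp add: eventually_sequentially)
qed

theorem lemma7:
  fixes b\<^sub>2 b\<^sub>3 :: real
  assumes "b\<^sub>2 > 0" and "property_P b\<^sub>2"
    and "b\<^sub>3 > 0" and "b\<^sub>3 * ln 2 / 8 > b\<^sub>2 + 4"
  shows "\<exists>b\<^sub>5 b\<^sub>6 :: real. b\<^sub>5 > 0 \<and> b\<^sub>6 > 5 \<and>
    (\<exists>K :: nat. \<forall>\<psi> :: nat \<Rightarrow> real. admissible \<psi> \<longrightarrow>
      (\<forall>k\<^sub>1 k\<^sub>2 r\<^sub>1 r\<^sub>2 :: nat.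
        1 \<le> k\<^sub>1 \<longrightarrow> 1 \<le> k\<^sub>2 \<longrightarrow> 1 \<le> r\<^sub>1 \<longrightarrow> 1 \<le> r\<^sub>2 \<longrightarrow>
        K \<le> k\<^sub>1 \<longrightarrow> K \<le> k\<^sub>2 \<longrightarrow> k\<^sub>2 \<le> k\<^sub>1 \<longrightarrow>
        \<bar>real k\<^sub>1 - real k\<^sub>2\<bar> \<le> b\<^sub>3 * tlog (real k\<^sub>1) \<longrightarrow>
        \<bar>real r\<^sub>1 - real r\<^sub>2\<bar> \<le> b\<^sub>3 * tlog (real k\<^sub>1) \<longrightarrow>
        real (card {(m, n). m \<in> S \<psi> k\<^sub>1 r\<^sub>1 \<and> n \<in> S \<psi> k\<^sub>2 r\<^sub>2 \<and>
            real (gcd m n) \<ge> 2 ^ (k\<^sub>1 + 1) * 2 powr (- real r\<^sub>2) / real k\<^sub>1 powr (b\<^sub>3 + 1) \<and>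
            real (omega (m * n div (gcd m n)\<^sup>2)) \<ge> b\<^sub>5 * tlog (real k\<^sub>1)})
          \<le> 2 ^ r\<^sub>1 * 2 ^ r\<^sub>2 * real k\<^sub>1 powr (- b\<^sub>6)))"
proof -
  define H :: real where "H = 64 * 84 ^ 4"
  \<comment> \<open>Chosen so that \<open>2\<close> to the power \<open>b\<^sub>5 log k\<^sub>1\<close> beats every power of \<open>k\<^sub>1\<close> lost below and still leaves
    a saving of \<open>k\<^sub>1\<^sup>6\<close>: the product over primes costs \<open>5H\<close>, the sizes of the two sets \<open>3/2\<close>, the
    factor \<open>X\<^bsup>1/2\<^esup>\<close> costs \<open>(b\<^sub>3 + 1)/2\<close>, and the difference of \<open>r\<^sub>1\<close> and \<open>r\<^sub>2\<close> at most \<open>b\<^sub>3/4\<close>.\<close>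
  define b\<^sub>5 where "b\<^sub>5 = (5 * H + 2 * b\<^sub>3 + 8) / ln 2"
  have H: "0 \<le> H" and b3: "0 < b\<^sub>3" using assms by (auto simp: H_def)
  have b5: "0 < b\<^sub>5" using H b3 by (simp add: b\<^sub>5_def)
  obtain K :: nat where K: "\<And>k. K \<le> k \<Longrightarrow> 5 \<le> ln (real k) \<and> (b\<^sub>3 + 1) * ln (real k) \<le> real k * ln 2"
    using eventually_log_small[of "b\<^sub>3 + 1"] by blast
  have main: "real (card {(m, n). m \<in> S \<psi> k\<^sub>1 r\<^sub>1 \<and> n \<in> S \<psi> k\<^sub>2 r\<^sub>2 \<and>
            real (gcd m n) \<ge> 2 ^ (k\<^sub>1 + 1) * 2 powr (- real r\<^sub>2) / real k\<^sub>1 powr (b\<^sub>3 + 1) \<and>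
            real (omega (m * n div (gcd m n)\<^sup>2)) \<ge> b\<^sub>5 * tlog (real k\<^sub>1)})
          \<le> 2 ^ r\<^sub>1 * 2 ^ r\<^sub>2 * real k\<^sub>1 powr (- 6)" (is "real (card ?T) \<le> _")
    if adm: "admissible \<psi>" and ge1: "1 \<le> k\<^sub>1" "1 \<le> k\<^sub>2" "1 \<le> r\<^sub>1" "1 \<le> r\<^sub>2"
      and k: "K \<le> k\<^sub>1" "k\<^sub>2 \<le> k\<^sub>1" and r: "\<bar>real r\<^sub>1 - real r\<^sub>2\<bar> \<le> b\<^sub>3 * tlog (real k\<^sub>1)"
    for \<psi> k\<^sub>1 k\<^sub>2 r\<^sub>1 r\<^sub>2
  proof (cases "S \<psi> k\<^sub>1 r\<^sub>1 = {} \<or> S \<psi> k\<^sub>2 r\<^sub>2 = {}")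
    case True
    then have "?T = {}" by auto
    then show ?thesis by (simp only: card.empty) simp
  next
    case False
    define A B where "A = S \<psi> k\<^sub>1 r\<^sub>1" and "B = S \<psi> k\<^sub>2 r\<^sub>2"
    define L where "L = ln (real k\<^sub>1)"
    define ln2 :: real where "ln2 = ln 2"
    \<comment> \<open>This is \<open>2\<^bsup>r\<^sub>2\<^esup> k\<^sub>1\<^bsup>b\<^sub>3 + 1\<^esup>\<close>. From here on all quantities are written as exponentials, so that the final
      comparison is one between linear expressions in \<open>L\<close> and \<open>ln2\<close>.\<close>
    define X where "X = exp (real r\<^sub>2 * ln2 + (b\<^sub>3 + 1) * L)"
    have L: "5 \<le> L" "(b\<^sub>3 + 1) * L \<le> real k\<^sub>1 * ln2" using K[OF k(1)] by (auto simp: L_def ln2_def)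
    have ln2: "0 < ln2" "ln2 < 1" using ln_2_less_1 by (auto simp: ln2_def)
    have tlog: "tlog (real k\<^sub>1) = L" using L by (simp add: tlog_def L_def)
    have two: "2 ^ j = exp (real j * ln2)" for j :: nat
      by (simp add: ln2_def exp_of_nat_mult)
    have k_exp: "real k\<^sub>1 = exp L" using ge1 by (simp add: L_def)
    from False have cards: "r\<^sub>2 \<le> k\<^sub>2" "real (card A) \<le> real k\<^sub>1 * 2 ^ r\<^sub>1" "real (card B) \<le> real k\<^sub>2 * 2 ^ r\<^sub>2"
      using adm ge1 by (auto simp: admissible_def A_def B_def)
    have fin: "finite A" "finite B"
      by (auto simp: A_def B_def S_def intro: finite_subset[of _ "{..2 ^ (k\<^sub>1 + 1)}"] finite_subset[of _ "{..2 ^ (k\<^sub>2 + 1)}"])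
    have pos: "0 \<notin> A" "0 \<notin> B" by (auto simp: A_def B_def S_def)
    have N: "real a \<le> 2 ^ (k\<^sub>1 + 1)" if "a \<in> A \<union> B" for a
    proof -
      have "a \<le> 2 ^ (k\<^sub>1 + 1) \<or> a \<le> 2 ^ (k\<^sub>2 + 1)" using that by (auto simp: A_def B_def S_def)
      moreover have "(2::nat) ^ (k\<^sub>2 + 1) \<le> 2 ^ (k\<^sub>1 + 1)" using k by (intro power_increasing) auto
      ultimately have "a \<le> 2 ^ (k\<^sub>1 + 1)" by linarith
      then have "real a \<le> real (2 ^ (k\<^sub>1 + 1))" by (rule of_nat_mono)
      then show ?thesis by simp
    qed
    have X0: "0 < X" by (simp add: X_def)
    have XJ: "X \<le> 2 ^ (2 * k\<^sub>1)"
    proof -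
      have "real r\<^sub>2 * ln2 \<le> real k\<^sub>1 * ln2" using cards(1) k(2) ln2 by (intro mult_right_mono) auto
      then show ?thesis unfolding X_def two using L by (simp add: algebra_simps)
    qed
    have thr: "2 ^ (k\<^sub>1 + 1) * 2 powr (- real r\<^sub>2) / real k\<^sub>1 powr (b\<^sub>3 + 1) = 2 ^ (k\<^sub>1 + 1) / X"
    proof -
      have "2 powr (- real r\<^sub>2) = exp (- (real r\<^sub>2 * ln2))" by (simp add: powr_def ln2_def)
      moreover have "real k\<^sub>1 powr (b\<^sub>3 + 1) = exp ((b\<^sub>3 + 1) * L)" using ge1 by (simp add: powr_def L_def)
      ultimately show ?thesis by (simp add: X_def exp_add exp_minus field_simps)
    qed
    have cardA: "real (card A) powr (3/4) \<le> exp (3/4 * (L + real r\<^sub>1 * ln2))"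
    proof -
      have "real (card A) powr (3/4) \<le> exp (L + real r\<^sub>1 * ln2) powr (3/4)"
        using cards(2) by (intro powr_mono2) (auto simp: exp_add k_exp two)
      then show ?thesis by (simp add: powr_def)
    qed
    have cardB: "real (card B) powr (3/4) \<le> exp (3/4 * (L + real r\<^sub>2 * ln2))"
    proof -
      have "real k\<^sub>2 * 2 ^ r\<^sub>2 \<le> real k\<^sub>1 * 2 ^ r\<^sub>2" using k by (intro mult_right_mono) auto
      with cards(3) have "real (card B) \<le> real k\<^sub>1 * 2 ^ r\<^sub>2" by (rule order_trans)
      then have "real (card B) powr (3/4) \<le> exp (L + real r\<^sub>2 * ln2) powr (3/4)"
        by (intro powr_mono2) (auto simp: exp_add k_exp two)
      then show ?thesis by (simp add: powr_def)
    qed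
    have lnJ: "ln (real (2 * k\<^sub>1)) = ln2 + L" using ge1 by (simp add: ln_mult ln2_def L_def)
    have weight: "2 powr (b\<^sub>5 * L) * X powr (- 1/2)
        = exp (b\<^sub>5 * L * ln2 - 1/2 * (real r\<^sub>2 * ln2 + (b\<^sub>3 + 1) * L))"
      by (simp add: powr_def X_def ln2_def exp_add[symmetric])
    have "real (card ?T) * (2 powr (b\<^sub>5 * L) * X powr (- 1/2))
        \<le> exp (H * (1 + 4 * (ln2 + L))) * (real (card A) powr (3/4) * real (card B) powr (3/4))"
      using card_pairs_many_primes_le[OF fin pos N X0 XJ, of "b\<^sub>5 * L"] ge1
      unfolding lnJ tlog thr A_def B_def H_def by simp
    also have "\<dots> \<le> exp (H * (1 + 4 * (ln2 + L)))
        * (exp (3/4 * (L + real r\<^sub>1 * ln2)) * exp (3/4 * (L + real r\<^sub>2 * ln2)))"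
      using cardA cardB by (intro mult_left_mono mult_mono) auto
    also have "\<dots> = exp (H * (1 + 4 * (ln2 + L)) + (3/4 * (L + real r\<^sub>1 * ln2) + 3/4 * (L + real r\<^sub>2 * ln2)))"
      by (simp only: exp_add)
    finally have "real (card ?T) * exp (b\<^sub>5 * L * ln2 - 1/2 * (real r\<^sub>2 * ln2 + (b\<^sub>3 + 1) * L))
        \<le> exp (H * (1 + 4 * (ln2 + L)) + (3/4 * (L + real r\<^sub>1 * ln2) + 3/4 * (L + real r\<^sub>2 * ln2)))"
      unfolding weight .
    then have "real (card ?T) \<le> exp (H * (1 + 4 * (ln2 + L)) + (3/4 * (L + real r\<^sub>1 * ln2) + 3/4 * (L + real r\<^sub>2 * ln2))
        - (b\<^sub>5 * L * ln2 - 1/2 * (real r\<^sub>2 * ln2 + (b\<^sub>3 + 1) * L)))"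
      by (simp only: exp_diff[of _ "b\<^sub>5 * L * ln2 - _"] pos_le_divide_eq exp_gt_zero)
    also have "\<dots> \<le> exp (real r\<^sub>1 * ln2 + real r\<^sub>2 * ln2 + (- 6) * L)"
    proof (rule iffD2[OF exp_le_cancel_iff])
      have e1: "H * (1 + 4 * (ln2 + L)) \<le> 5 * (H * L)"
        using mult_left_mono[of "1 + 4 * (ln2 + L)" "5 * L" H] H L ln2 by simp
      have e2: "real r\<^sub>2 * ln2 - real r\<^sub>1 * ln2 \<le> b\<^sub>3 * L"
      proof -
        have "(real r\<^sub>2 - real r\<^sub>1) * ln2 \<le> (b\<^sub>3 * L) * ln2" using r ln2 by (intro mult_right_mono) (auto simp: tlog)
        also have "\<dots> \<le> (b\<^sub>3 * L) * 1" using ln2 b3 L by (intro mult_left_mono) auto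
        finally show ?thesis by (simp add: left_diff_distrib)
      qed
      have e3: "b\<^sub>5 * L * ln2 = 5 * (H * L) + 2 * (b\<^sub>3 * L) + 8 * L"
        using ln2 by (simp add: b\<^sub>5_def ln2_def field_simps)
      have e4: "0 \<le> b\<^sub>3 * L" using b3 L by simp
      \<comment> \<open>Stated for variables in place of the products, as the comparison is linear in these.\<close>
      have arith: "h + (3/4 * (L + a) + 3/4 * (L + b)) - (5 * e + 2 * u + 8 * L - 1/2 * (b + (u + L)))
          \<le> a + b + (- 6) * L"
        if "h \<le> 5 * e" "b - a \<le> u" "0 \<le> u" for h e a b u
        using that by (simp add: field_simps)
      show "H * (1 + 4 * (ln2 + L)) + (3/4 * (L + real r\<^sub>1 * ln2) + 3/4 * (L + real r\<^sub>2 * ln2))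
          - (b\<^sub>5 * L * ln2 - 1/2 * (real r\<^sub>2 * ln2 + (b\<^sub>3 + 1) * L)) \<le> real r\<^sub>1 * ln2 + real r\<^sub>2 * ln2 + (- 6) * L"
        unfolding e3 distrib_right[of "b\<^sub>3" 1 L] mult_1_left by (rule arith[OF e1 e2 e4])
    qed
    also have "\<dots> = 2 ^ r\<^sub>1 * 2 ^ r\<^sub>2 * real k\<^sub>1 powr (- 6)"
      unfolding two exp_add using ge1 by (simp add: powr_def L_def)
    finally show ?thesis .
  qed
  show ?thesis
    by (rule exI[of _ b\<^sub>5], rule exI[of _ 6], intro conjI exI[of _ K] allI impI) (use b5 main in auto)
qed

end
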